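(* Let $X$ be a Polish space. Then $(\mathcal{B}_1(X),<_p)\hookrightarrow([0,1]^{<\omega_1}_{\searrow 0},<_{altlex})$.
   Context: For posets $(P,<_P)$, $(Q,<_Q)$, $P\hookrightarrow Q$ means there is $\Phi:P\to Q$ with $p<_P q\Rightarrow \Phi(p)<_Q\Phi(q)$. $\mathcal{B}_1(X)$ is the set of real-valued Baire class $1$ functions on $X$ with the pointwise order: $f<_p g$ iff $f\le g$ everywhere and $f(x)<g(x)$ for some $x$. $[0,1]^{<\omega_1}_{\searrow 0}$ is the set of strictly decreasing transfinite sequences $(x_\alpha)_{\alpha\le\xi}$ ($\xi<\omega_1$) in $[0,1]$ with last element $0$. Parity of an ordinal $\gamma+n$ ($\gamma$ limit or $0$, $n<\omega$) is the parity of $n$. For distinct sequences $\bar x,\bar x'$ with $\delta$ the least index where they differ, $\bar x<_{altlex}\bar x'$ iff ($\delta$ even and $x_\delta<x'_\delta$) or ($\delta$ odd and $x_\delta>x'_\delta$). *)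

theory Defs
  imports "HOL-Analysis.Analysis"
begin

section \<open>The countable ordinals\<close>

text \<open>
  The ordinals below \<open>\<omega>\<^sub>1\<close> are the points of the well-order \<^term>\<open>cardSuc natLeq\<close>, whose order
  type is the successor cardinal of \<open>\<omega>\<close>.
\<close>

lemma omega1_Card_order: "Card_order (cardSuc natLeq)"
  by (rule cardSuc_Card_order[OF natLeq_Card_order])

lemma omega1_Well_order: "Well_order (cardSuc natLeq)"
  using omega1_Card_order by (rule card_order_on_well_order_on)

context
  includes cardinal_syntax
begin

lemma omega1_natLeq_less: "natLeq <o cardSuc natLeq"
  by (rule cardSuc_greater[OF natLeq_Card_order])

lemma omega1_Field_uncountable: "\<not> countable (Field (cardSuc natLeq))"
proof
  assume "countable (Field (cardSuc natLeq))"
  then have "|Field (cardSuc natLeq)| \<le>o |UNIV :: nat set|"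
    unfolding countable_def card_of_ordLeq[symmetric] by blast
  moreover have "|Field (cardSuc natLeq)| =o cardSuc natLeq"
    by (rule card_of_Field_ordIso[OF omega1_Card_order])
  ultimately have "cardSuc natLeq \<le>o natLeq"
    using card_of_nat ordIso_ordLeq_trans ordIso_symmetric ordLeq_ordIso_trans by blast
  then show False
    using omega1_natLeq_less not_ordLess_ordLeq by blast
qed

end

typedef omega1 = "Field (cardSuc natLeq)"
proof -
  have "Field (cardSuc natLeq) \<noteq> {}"
    using omega1_Field_uncountable by (metis countable_empty)
  then show ?thesis by blast
qed

instantiation omega1 :: wellorder
begin

definition less_eq_omega1 :: "omega1 \<Rightarrow> omega1 \<Rightarrow> bool" where
  "\<alpha> \<le> \<beta> \<longleftrightarrow> (Rep_omega1 \<alpha>, Rep_omega1 \<beta>) \<in> cardSuc natLeq"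

definition less_omega1 :: "omega1 \<Rightarrow> omega1 \<Rightarrow> bool" where
  "(\<alpha> :: omega1) < \<beta> \<longleftrightarrow> \<alpha> \<le> \<beta> \<and> \<alpha> \<noteq> \<beta>"

instance
proof
  let ?r = "cardSuc natLeq"
  have lin: "refl_on (Field ?r) ?r" "trans ?r" "antisym ?r" "total_on (Field ?r) ?r"
    and wf: "wf (?r - Id)"
    using omega1_Well_order
    by (auto simp: well_order_on_def linear_order_on_def partial_order_on_def preorder_on_def)
  fix x y z :: omega1
  show refl: "x \<le> x"
    using lin(1) Rep_omega1[of x] by (auto simp: less_eq_omega1_def refl_on_def)
  show "x \<le> y \<Longrightarrow> y \<le> z \<Longrightarrow> x \<le> z"
    using lin(2) unfolding less_eq_omega1_def trans_def by blast
  show anti: "x \<le> y \<Longrightarrow> y \<le> x \<Longrightarrow> x = y"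
    using lin(3) unfolding less_eq_omega1_def antisym_def by (metis Rep_omega1_inject)
  show "(x < y) = (x \<le> y \<and> \<not> y \<le> x)"
    using anti refl unfolding less_omega1_def by auto
  show "x \<le> y \<or> y \<le> x"
    using lin(4) refl Rep_omega1[of x] Rep_omega1[of y]
    unfolding less_eq_omega1_def total_on_def by (metis Rep_omega1_inject)
next
  let ?r = "cardSuc natLeq"
  fix P :: "omega1 \<Rightarrow> bool" and a :: omega1
  assume step: "\<And>x. (\<And>y. y < x \<Longrightarrow> P y) \<Longrightarrow> P x"
  have "wf (?r - Id)"
    using omega1_Well_order by (simp add: well_order_on_def)
  then have "wf (inv_image (?r - Id) Rep_omega1)"
    by (rule wf_inv_image)
  then show "P a"
  proof (induction a rule: wf_induct_rule)
    case (less x)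
    show ?case
    proof (rule step)
      fix y :: omega1
      assume "y < x"
      then have "(y, x) \<in> inv_image (?r - Id) Rep_omega1"
        by (auto simp: less_omega1_def less_eq_omega1_def Rep_omega1_inject)
      then show "P y" by (rule less.IH)
    qed
  qed
qed

end

text \<open>
  These two properties determine the well-order \<^typ>\<open>omega1\<close> up to isomorphism.
\<close>

lemma uncountable_omega1: "\<not> countable (UNIV :: omega1 set)"
proof
  assume "countable (UNIV :: omega1 set)"
  then have "countable (range Rep_omega1)" by blast
  then show False
    using omega1_Field_uncountable type_definition.Rep_range[OF type_definition_omega1] by simp
qed

context
  includes cardinal_syntax
begin

lemma countable_lessThan_omega1: "countable {..<\<alpha> :: omega1}"
proof -
  let ?r = "cardSuc natLeq"
  have "|underS ?r (Rep_omega1 \<alpha>)| <o ?r"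
    by (rule card_of_underS[OF omega1_Card_order Rep_omega1])
  then have "|underS ?r (Rep_omega1 \<alpha>)| \<le>o natLeq"
    using cardSuc_ordLeq_ordLess[OF natLeq_Card_order card_of_Card_order] by blast
  then have "|underS ?r (Rep_omega1 \<alpha>)| \<le>o |UNIV :: nat set|"
    using card_of_nat ordIso_symmetric ordLeq_ordIso_trans by blast
  then have "countable (underS ?r (Rep_omega1 \<alpha>))"
    unfolding countable_def card_of_ordLeq[symmetric] by blast
  moreover have "Rep_omega1 ` {..<\<alpha>} \<subseteq> underS ?r (Rep_omega1 \<alpha>)"
    by (auto simp: underS_def less_omega1_def less_eq_omega1_def Rep_omega1_inject)
  ultimately have "countable (Rep_omega1 ` {..<\<alpha>})"
    by (rule countable_subset[rotated])
  then show ?thesis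
    by (rule countable_image_inj_on) (simp add: inj_on_def Rep_omega1_inject)
qed

end

lemma ex_gt_omega1: "\<exists>\<beta>. (\<alpha> :: omega1) < \<beta>"
proof (rule ccontr)
  assume "\<not> ?thesis"
  then have "(UNIV :: omega1 set) \<subseteq> insert \<alpha> {..<\<alpha>}"
    by (auto simp: not_less order_le_less)
  moreover have "countable (insert \<alpha> {..<\<alpha>})"
    using countable_lessThan_omega1 by simp
  ultimately have "countable (UNIV :: omega1 set)" by (rule countable_subset)
  with uncountable_omega1 show False by (rule notE)
qed


section \<open>Parity of ordinals\<close>

definition succ_omega1 :: "omega1 \<Rightarrow> omega1" where
  "succ_omega1 \<alpha> = (LEAST \<beta>. \<alpha> < \<beta>)"

definition limit_or_zero :: "omega1 \<Rightarrow> bool" where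
  "limit_or_zero \<gamma> \<longleftrightarrow> (\<nexists>\<beta>. \<gamma> = succ_omega1 \<beta>)"

text \<open>The ordinal \<open>\<gamma> + n\<close> is the \<open>n\<close>-th iterated successor of \<open>\<gamma>\<close>.\<close>

definition even_ordinal :: "omega1 \<Rightarrow> bool" where
  "even_ordinal \<alpha> \<longleftrightarrow> (\<exists>\<gamma> n. limit_or_zero \<gamma> \<and> \<alpha> = (succ_omega1 ^^ n) \<gamma> \<and> even n)"

definition odd_ordinal :: "omega1 \<Rightarrow> bool" where
  "odd_ordinal \<alpha> \<longleftrightarrow> (\<exists>\<gamma> n. limit_or_zero \<gamma> \<and> \<alpha> = (succ_omega1 ^^ n) \<gamma> \<and> odd n)"

lemma less_succ_omega1: "\<alpha> < succ_omega1 \<alpha>"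
  unfolding succ_omega1_def using ex_gt_omega1 by (rule LeastI_ex)

lemma inj_succ_omega1: "succ_omega1 \<alpha> = succ_omega1 \<beta> \<Longrightarrow> \<alpha> = \<beta>"
proof (rule ccontr)
  assume eq: "succ_omega1 \<alpha> = succ_omega1 \<beta>" and "\<alpha> \<noteq> \<beta>"
  have le: "succ_omega1 \<gamma> \<le> \<delta>" if "\<gamma> < \<delta>" for \<gamma> \<delta>
    unfolding succ_omega1_def using that by (rule Least_le)
  from \<open>\<alpha> \<noteq> \<beta>\<close> have "\<alpha> < \<beta> \<or> \<beta> < \<alpha>" by (rule neq_iff[THEN iffD1])
  then show False
    using le[of \<alpha> \<beta>] le[of \<beta> \<alpha>] less_succ_omega1[of \<alpha>] less_succ_omega1[of \<beta>] eq by auto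
qed

lemma limit_decomposition: "\<exists>\<gamma> n. limit_or_zero \<gamma> \<and> \<alpha> = (succ_omega1 ^^ n) \<gamma>"
proof (induction \<alpha> rule: less_induct)
  case (less \<alpha>)
  show ?case
  proof (cases "limit_or_zero \<alpha>")
    case True
    then show ?thesis by (metis funpow_0)
  next
    case False
    then obtain \<beta> where \<beta>: "\<alpha> = succ_omega1 \<beta>" by (auto simp: limit_or_zero_def)
    then obtain \<gamma> n where "limit_or_zero \<gamma>" "\<beta> = (succ_omega1 ^^ n) \<gamma>"
      using less.IH less_succ_omega1 by blast
    then have "limit_or_zero \<gamma> \<and> \<alpha> = (succ_omega1 ^^ Suc n) \<gamma>" using \<beta> by simp
    then show ?thesis by blast
  qed
qed

lemma limit_decomposition_unique:
  assumes "limit_or_zero \<gamma>" "limit_or_zero \<gamma>'"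
    and "(succ_omega1 ^^ n) \<gamma> = (succ_omega1 ^^ m) \<gamma>'"
  shows "\<gamma> = \<gamma>' \<and> n = m"
  using assms(3)
proof (induction n arbitrary: m)
  case 0
  show ?case
  proof (cases m)
    case 0
    then show ?thesis using "0.prems" by simp
  next
    case (Suc k)
    then have "\<gamma> = succ_omega1 ((succ_omega1 ^^ k) \<gamma>')" using "0.prems" by simp
    then show ?thesis using assms(1) unfolding limit_or_zero_def by blast
  qed
next
  case (Suc n)
  show ?case
  proof (cases m)
    case 0
    then have "\<gamma>' = succ_omega1 ((succ_omega1 ^^ n) \<gamma>)" using Suc.prems by simp
    then show ?thesis using assms(2) unfolding limit_or_zero_def by blast
  next
    case (Suc k)
    then have "(succ_omega1 ^^ n) \<gamma> = (succ_omega1 ^^ k) \<gamma>'"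
      using Suc.prems inj_succ_omega1 by simp
    then show ?thesis using Suc.IH Suc by simp
  qed
qed

lemma odd_ordinal_iff_not_even: "odd_ordinal \<alpha> \<longleftrightarrow> \<not> even_ordinal \<alpha>"
proof -
  obtain \<gamma> n where \<gamma>: "limit_or_zero \<gamma>" "\<alpha> = (succ_omega1 ^^ n) \<gamma>"
    using limit_decomposition by blast
  have n: "m = n" if "limit_or_zero \<gamma>'" "\<alpha> = (succ_omega1 ^^ m) \<gamma>'" for \<gamma>' m
    using limit_decomposition_unique[OF that(1) \<gamma>(1)] that(2) \<gamma>(2) by simp
  have "odd_ordinal \<alpha> \<longleftrightarrow> odd n" "even_ordinal \<alpha> \<longleftrightarrow> even n"
    unfolding odd_ordinal_def even_ordinal_def using \<gamma> n by blast+
  then show ?thesis by simp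
qed


section \<open>Strictly decreasing transfinite sequences\<close>

text \<open>
  A sequence \<open>(x\<^sub>\<alpha>)\<close>, \<open>\<alpha> \<le> \<xi>\<close>, is a partial function on \<^typ>\<open>omega1\<close> with domain \<open>{..\<xi>}\<close>.
\<close>

definition decreasing_seqs :: "(omega1 \<rightharpoonup> real) set" where
  "decreasing_seqs = {x. \<exists>\<xi>. dom x = {..\<xi>} \<and> ran x \<subseteq> {0..1} \<and>
     (\<forall>\<alpha> \<beta>. \<alpha> < \<beta> \<and> \<beta> \<le> \<xi> \<longrightarrow> the (x \<beta>) < the (x \<alpha>)) \<and> x \<xi> = Some 0}"

definition first_diff :: "(omega1 \<rightharpoonup> real) \<Rightarrow> (omega1 \<rightharpoonup> real) \<Rightarrow> omega1" where
  "first_diff x x' = (LEAST \<alpha>. x \<alpha> \<noteq> x' \<alpha>)"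

text \<open>
  By \<open>first_diff_Some\<close> below, distinct members of \<^const>\<open>decreasing_seqs\<close> are both defined at their
  least difference, so \<^const>\<open>the\<close> never meets \<^const>\<open>None\<close> here.
\<close>

definition altlex_less :: "(omega1 \<rightharpoonup> real) \<Rightarrow> (omega1 \<rightharpoonup> real) \<Rightarrow> bool" where
  "altlex_less x x' \<longleftrightarrow> x \<noteq> x' \<and>
     (let \<delta> = first_diff x x' in
        even_ordinal \<delta> \<and> the (x \<delta>) < the (x' \<delta>) \<or>
        odd_ordinal \<delta> \<and> the (x \<delta>) > the (x' \<delta>))"

lemma first_diff_neq:
  assumes "x \<noteq> x'"
  shows "x (first_diff x x') \<noteq> x' (first_diff x x')"
proof -
  have "\<exists>\<alpha>. x \<alpha> \<noteq> x' \<alpha>" using assms by auto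
  then show ?thesis
    unfolding first_diff_def by (rule LeastI_ex[where P = "\<lambda>\<alpha>. x \<alpha> \<noteq> x' \<alpha>"])
qed

lemma first_diff_below: "\<alpha> < first_diff x x' \<Longrightarrow> x \<alpha> = x' \<alpha>"
  unfolding first_diff_def using not_less_Least by blast

lemma first_diff_commute: "first_diff x x' = first_diff x' x"
  proof -
  have "(\<lambda>\<alpha>. x \<alpha> \<noteq> x' \<alpha>) = (\<lambda>\<alpha>. x' \<alpha> \<noteq> x \<alpha>)" by auto
  then show ?thesis unfolding first_diff_def by simp
qed

lemma first_diff_le_last:
  assumes "x \<in> decreasing_seqs" "x' \<in> decreasing_seqs" "x \<noteq> x'" "dom x = {..\<xi>}"
  shows "first_diff x x' \<le> \<xi>"
proof (rule ccontr)
  assume "\<not> first_diff x x' \<le> \<xi>"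
  then have less: "\<xi> < first_diff x x'" by simp
  obtain \<zeta> where "dom x = {..\<zeta>}" "x \<zeta> = Some 0"
    using assms(1) by (auto simp: decreasing_seqs_def)
  then have "x \<xi> = Some 0"
    using assms(4) by (metis atMost_eq_iff)
  then have x': "x' \<xi> = Some 0"
    using first_diff_below[OF less] by simp
  obtain \<xi>' where \<xi>': "dom x' = {..\<xi>'}" "ran x' \<subseteq> {0..1}"
    "\<And>\<alpha> \<beta>. \<alpha> < \<beta> \<Longrightarrow> \<beta> \<le> \<xi>' \<Longrightarrow> the (x' \<beta>) < the (x' \<alpha>)" "x' \<xi>' = Some 0"
    using assms(2) by (auto simp: decreasing_seqs_def)
  have "\<xi> \<le> \<xi>'" using x' \<xi>'(1) by blast
  then have "\<xi> = \<xi>'" using \<xi>'(3)[of \<xi> \<xi>'] x' \<xi>'(4) by (force simp: order_le_less)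
  then have "first_diff x x' \<notin> dom x" "first_diff x x' \<notin> dom x'"
    using less assms(4) \<xi>'(1) by auto
  then show False
    using first_diff_neq[OF assms(3)] by (simp add: domIff)
qed

lemma first_diff_Some:
  assumes "x \<in> decreasing_seqs" "x' \<in> decreasing_seqs" "x \<noteq> x'"
  shows "\<exists>a b. x (first_diff x x') = Some a \<and> x' (first_diff x x') = Some b \<and> a \<noteq> b"
proof -
  obtain \<xi> \<xi>' where "dom x = {..\<xi>}" "dom x' = {..\<xi>'}"
    using assms(1,2) by (auto simp: decreasing_seqs_def)
  then have "first_diff x x' \<in> dom x" "first_diff x x' \<in> dom x'"
    using first_diff_le_last[OF assms(1,2,3)] first_diff_le_last[OF assms(2,1)] assms(3)
    by (auto simp: first_diff_commute[of x' x])
  then show ?thesis using first_diff_neq[OF assms(3)] by force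
qed


section \<open>Polish spaces and Baire class 1 functions\<close>

definition Polish_space :: "'a topology \<Rightarrow> bool" where
  "Polish_space X \<longleftrightarrow> separable_space X \<and> completely_metrizable_space X"

text \<open>
  Functions on \<open>X\<close> are represented by their extensional versions on \<^term>\<open>topspace X\<close>.
\<close>

definition baire_one :: "'a topology \<Rightarrow> ('a \<Rightarrow> real) set" where
  "baire_one X = {f \<in> extensional (topspace X).
     \<exists>F :: nat \<Rightarrow> 'a \<Rightarrow> real. (\<forall>n. continuous_map X euclideanreal (F n)) \<and>
       (\<forall>x \<in> topspace X. (\<lambda>n. F n x) \<longlonglongrightarrow> f x)}"

definition pointwise_less :: "'a topology \<Rightarrow> ('a \<Rightarrow> real) \<Rightarrow> ('a \<Rightarrow> real) \<Rightarrow> bool" where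
  "pointwise_less X f g \<longleftrightarrow>
     (\<forall>x \<in> topspace X. f x \<le> g x) \<and> (\<exists>x \<in> topspace X. f x < g x)"


section \<open>Order-preserving maps between posets\<close>

text \<open>The map need not be injective nor reflect the order.\<close>

definition order_embeds ::
  "'a set \<Rightarrow> ('a \<Rightarrow> 'a \<Rightarrow> bool) \<Rightarrow> 'b set \<Rightarrow> ('b \<Rightarrow> 'b \<Rightarrow> bool) \<Rightarrow> bool" where
  "order_embeds P less_P Q less_Q \<longleftrightarrow>
     (\<exists>\<Phi>. \<Phi> \<in> P \<rightarrow> Q \<and> (\<forall>p \<in> P. \<forall>q \<in> P. less_P p q \<longrightarrow> less_Q (\<Phi> p) (\<Phi> q)))"

end

theory Submission
  imports Defs
begin

text \<open>
  For a pair of disjoint \<open>G\<^sub>\<delta>\<close> sets \<open>A\<close>, \<open>B\<close> of a Polish space, alternately intersecting with \<open>A\<close> and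
  with \<open>B\<close> and taking closures yields a decreasing transfinite sequence of closed sets. Once
  two of its terms agree, \<open>A\<close> and \<open>B\<close> are both dense in the common value, which is therefore empty by
  the Baire category theorem; so the sequence decreases strictly until it reaches the empty set, and
  it does so at a countable stage. At the first stage where the sequences of \<open>(A, B)\<close> and \<open>(A', B')\<close>
  differ, where \<open>A \<subseteq> A'\<close> and \<open>B' \<subseteq> B\<close>, the inclusion goes one way or the other according to parity,
  and if \<open>A' \<inter> B \<noteq> {}\<close> such a stage exists, since a point of \<open>A' \<inter> B\<close> would otherwise stay in every term.
  A strictly monotone map from closed sets to \<open>[0,1]\<close> turns this into the alternating
  lexicographical order. A Baire class 1 function \<open>f\<close> is encoded by the sets \<open>{f \<ge> q}\<close> and \<open>{f \<le> p}\<close>,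
  for all rational \<open>p < q\<close> simultaneously, in the product of \<open>X\<close> with a countable discrete space.
\<close>

section \<open>Separable and completely metrizable spaces\<close>

lemma second_countable_if_separable_metrizable:
  assumes "separable_space X" "metrizable_space X"
  shows "second_countable X"
proof -
  obtain M d where "Metric_space M d" and X: "X = Metric_space.mtopology M d"
    using assms(2) unfolding metrizable_space_def by blast
  then interpret Metric_space M d by simp
  obtain D where D: "countable D" "D \<subseteq> M" "mtopology closure_of D = M"
    using assms(1) unfolding separable_space_def X by auto
  let ?\<B> = "(\<lambda>(c, n). mball c (inverse (Suc n))) ` (D \<times> (UNIV :: nat set))"
  show ?thesis
    unfolding second_countable_def
  proof (intro exI[of _ ?\<B>] conjI allI impI)
    show "countable ?\<B>" using D(1) by simp
    show "\<forall>V \<in> ?\<B>. openin X V" by (auto simp: X)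
  next
    fix U x assume "openin X U \<and> x \<in> U"
    then obtain r where r: "x \<in> M" "r > 0" "mball x r \<subseteq> U"
      unfolding X openin_mtopology by blast
    \<comment> \<open>Half the radius suffices: a ball around \<open>c\<close> that contains
      \<open>x\<close> then lies within distance \<open>r\<close> of \<open>x\<close> by the
      triangle inequality.\<close>
    obtain n where n: "inverse (real (Suc n)) < r / 2"
      using reals_Archimedean[of "r / 2"] r(2) by auto
    have "x \<in> mtopology closure_of D" using D(3) r(1) by simp
    then obtain c where c: "c \<in> D" "c \<in> mball x (inverse (Suc n))"
      unfolding metric_closure_of by (auto dest!: spec[of _ "inverse (real (Suc n))"])
    have "x \<in> mball c (inverse (Suc n))"
      using c(2) by (simp add: commute)
    moreover have "mball c (inverse (Suc n)) \<subseteq> mball x r"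
    proof
      fix y assume y: "y \<in> mball c (inverse (Suc n))"
      then have "d x y \<le> d x c + d c y" using c(2) by (auto intro: triangle)
      then show "y \<in> mball x r" using y c(2) n by auto
    qed
    ultimately show "\<exists>V \<in> ?\<B>. x \<in> V \<and> V \<subseteq> U"
      using c(1) r(3) by blast
  qed
qed

lemma second_countable_prod_discrete:
  assumes "second_countable X" "countable K"
  shows "second_countable (prod_topology X (discrete_topology K))"
proof -
  obtain \<B> where \<B>: "countable \<B>" "\<And>V. V \<in> \<B> \<Longrightarrow> openin X V"
    "\<And>U x. openin X U \<Longrightarrow> x \<in> U \<Longrightarrow> \<exists>V \<in> \<B>. x \<in> V \<and> V \<subseteq> U"
    using assms(1) unfolding second_countable_def by auto
  let ?\<C> = "(\<lambda>(V, k). V \<times> {k}) ` (\<B> \<times> K)"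
  show ?thesis
    unfolding second_countable_def
  proof (intro exI[of _ ?\<C>] conjI allI impI)
    show "countable ?\<C>" using \<B>(1) assms(2) by simp
    show "\<forall>V \<in> ?\<C>. openin (prod_topology X (discrete_topology K)) V"
      using \<B>(2) by (auto simp: openin_prod_Times_iff)
  next
    fix U z assume Uz: "openin (prod_topology X (discrete_topology K)) U \<and> z \<in> U"
    obtain x k where z: "z = (x, k)" by (cases z)
    have "\<exists>S T. openin X S \<and> T \<subseteq> K \<and> x \<in> S \<and> k \<in> T \<and> S \<times> T \<subseteq> U"
      using Uz unfolding z openin_prod_topology_alt openin_discrete_topology by simp
    then obtain S T where ST: "openin X S" "T \<subseteq> K" "x \<in> S" "k \<in> T" "S \<times> T \<subseteq> U"
      by blast
    then obtain V where V: "V \<in> \<B>" "x \<in> V" "V \<subseteq> S" using \<B>(3) by blast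
    show "\<exists>W \<in> ?\<C>. z \<in> W \<and> W \<subseteq> U"
      by (rule bexI[of _ "V \<times> {k}"]) (use V ST in \<open>auto simp: z\<close>)
  qed
qed

section \<open>Baire category on closed subspaces\<close>

text \<open>Every open set in a representation of \<open>A\<close> or \<open>B\<close> contains a
  dense set, so the Baire category theorem applies to both countable families taken
  together.\<close>

lemma dense_gdelta_Int:
  assumes Z: "completely_metrizable_space Z"
    and A: "gdelta_in Z A" "Z closure_of A = topspace Z"
    and B: "gdelta_in Z B" "Z closure_of B = topspace Z"
  shows "Z closure_of (A \<inter> B) = topspace Z"
proof -
  obtain \<U> where \<U>: "countable \<U>" "\<U> \<subseteq> Collect (openin Z)" "\<Inter> \<U> = A"
    using A(1) by (auto simp: gdelta_in_alt intersection_of_def)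
  obtain \<V> where \<V>: "countable \<V>" "\<V> \<subseteq> Collect (openin Z)" "\<Inter> \<V> = B"
    using B(1) by (auto simp: gdelta_in_alt intersection_of_def)
  have dense: "Z closure_of S = topspace Z" if "Z closure_of T = topspace Z" "T \<subseteq> S" for S T
    using closure_of_mono[OF that(2), of Z] that(1) closure_of_subset_topspace[of Z S] by simp
  have "Z closure_of \<Inter> (\<U> \<union> \<V>) = topspace Z"
  proof (rule Baire_category)
    fix S assume S: "S \<in> \<U> \<union> \<V>"
    then have "A \<subseteq> S \<or> B \<subseteq> S" unfolding \<U>(3)[symmetric] \<V>(3)[symmetric] by auto
    then have "Z closure_of S = topspace Z" using dense[OF A(2)] dense[OF B(2)] by blast
    then show "openin Z S \<and> Z closure_of S = topspace Z" using S \<U>(2) \<V>(2) by blast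
  qed (use Z \<U>(1) \<V>(1) in auto)
  then show ?thesis by (simp add: Inf_union_distrib \<U>(3) \<V>(3))
qed

text \<open>A closed subspace inherits complete metrizability, so the traces of \<open>A\<close> and
  \<open>B\<close> on \<open>C\<close> meet in a dense subset of \<open>C\<close>; this subset is
  empty by disjointness.\<close>

lemma empty_if_disjoint_dense_gdelta:
  assumes Z: "completely_metrizable_space Z" and C: "closedin Z C"
    and A: "gdelta_in Z A" "Z closure_of (A \<inter> C) = C"
    and B: "gdelta_in Z B" "Z closure_of (B \<inter> C) = C"
    and disj: "A \<inter> B = {}"
  shows "C = {}"
proof -
  let ?Y = "subtopology Z C"
  have top: "topspace ?Y = C" using closedin_subset[OF C] by auto
  have "?Y closure_of (A \<inter> C \<inter> (B \<inter> C)) = topspace ?Y"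
  proof (rule dense_gdelta_Int)
    show "completely_metrizable_space ?Y"
      using Z C by (rule completely_metrizable_space_closedin)
    show "gdelta_in ?Y (A \<inter> C)" "gdelta_in ?Y (B \<inter> C)"
      using A(1) B(1) by (auto simp: gdelta_in_subtopology)
    show "?Y closure_of (A \<inter> C) = topspace ?Y" "?Y closure_of (B \<inter> C) = topspace ?Y"
      unfolding top using A(2) B(2) by (simp_all add: closure_of_subtopology Int_absorb1)
  qed
  moreover have "A \<inter> C \<inter> (B \<inter> C) = {}" using disj by blast
  ultimately show ?thesis using top by simp
qed

section \<open>Closed sets coded by reals\<close>

text \<open>Enumerate a countable base and add the weight \<open>(1/2)^(n+1)\<close> for each
  \<open>n\<close> whose basic set meets \<open>C\<close>. For \<open>C \<subset> D\<close>, some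
  basic set around a point of \<open>D\<close> misses \<open>C\<close>, so its weight counts for
  \<open>D\<close> only.\<close>

lemma strictly_monotone_closed_sets:
  assumes "second_countable Z"
  shows "\<exists>\<Psi> :: 'a set \<Rightarrow> real. \<Psi> {} = 0 \<and> range \<Psi> \<subseteq> {0..1} \<and>
    (\<forall>C D. closedin Z C \<longrightarrow> closedin Z D \<longrightarrow> C \<subset> D \<longrightarrow> \<Psi> C < \<Psi> D)"
proof -
  obtain \<B> where \<B>: "countable \<B>" "\<And>V. V \<in> \<B> \<Longrightarrow> openin Z V"
    "\<And>U x. openin Z U \<Longrightarrow> x \<in> U \<Longrightarrow> \<exists>V \<in> \<B>. x \<in> V \<and> V \<subseteq> U"
    using assms unfolding second_countable_def by auto
  \<comment> \<open>The empty set makes the enumerated family nonempty; it meets nothing and so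
    never contributes weight.\<close>
  define U where "U = from_nat_into (insert {} \<B>)"
  have U: "range U = insert {} \<B>"
    unfolding U_def using \<B>(1) by (simp add: range_from_nat_into)
  define t where "t C n = (if U n \<inter> C = {} then 0 else (1 / 2 :: real) ^ Suc n)" for C n
  have t: "0 \<le> t C n" "t C n \<le> (1 / 2) ^ Suc n" for C n by (auto simp: t_def)
  have sm: "summable (t C)" for C
    by (rule summable_comparison_test_ev[OF _ sums_summable[OF power_half_series]])
      (use t in auto)
  show ?thesis
  proof (intro exI[of _ "\<lambda>C. suminf (t C)"] conjI allI impI image_subsetI)
    have "t {} = (\<lambda>n. 0)" by (simp add: t_def fun_eq_iff)
    then show "suminf (t {}) = 0" by simp
    show "suminf (t C) \<in> {0..1}" for C
      using suminf_nonneg[OF sm t(1)] suminf_le[OF t(2) sm sums_summable[OF power_half_series]]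
        sums_unique[OF power_half_series] by auto
    fix C D assume CD: "closedin Z C" "closedin Z D" "C \<subset> D"
    then obtain x where x: "x \<in> D" "x \<in> topspace Z - C" using closedin_subset by blast
    then obtain V where V: "V \<in> \<B>" "x \<in> V" "V \<subseteq> topspace Z - C"
      using \<B>(3)[of "topspace Z - C" x] CD(1) by blast
    then obtain n where n: "U n = V" using U by (metis insertCI rangeE)
    have le: "t C m \<le> t D m" for m using CD(3) by (auto simp: t_def)
    have "t C n < t D n" using n V x by (auto simp: t_def)
    then have "0 < (\<Sum>m. t D m - t C m)"
      using le by (intro suminf_pos2[where i = n] summable_diff sm) auto
    then show "suminf (t C) < suminf (t D)"
      by (simp add: suminf_diff[OF sm sm, symmetric])
  qed
qed

section \<open>The alternating derivation\<close>

lemma even_succ_omega1: "even_ordinal (succ_omega1 \<alpha>) \<longleftrightarrow> \<not> even_ordinal \<alpha>"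
proof -
  obtain \<gamma> n where \<gamma>: "limit_or_zero \<gamma>" "\<alpha> = (succ_omega1 ^^ n) \<gamma>"
    using limit_decomposition by blast
  then have "succ_omega1 \<alpha> = (succ_omega1 ^^ Suc n) \<gamma>" by simp
  then have "even_ordinal (succ_omega1 \<alpha>) \<longleftrightarrow> even (Suc n)"
    unfolding even_ordinal_def using \<gamma>(1) limit_decomposition_unique by metis
  moreover have "even_ordinal \<alpha> \<longleftrightarrow> even n"
    unfolding even_ordinal_def using \<gamma> limit_decomposition_unique by metis
  ultimately show ?thesis by simp
qed

lemma succ_omega1_le: "\<alpha> < \<beta> \<Longrightarrow> succ_omega1 \<alpha> \<le> \<beta>"
  unfolding succ_omega1_def by (rule Least_le)

declare INF_cong[fundef_cong]

text \<open>No case distinction is made between zero, successors and limits. At the least ordinal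
  the intersection is over no indices, so the term is the closure of \<open>A\<close>; at a
  successor it is just the preceding term, since the terms decrease.\<close>

function alternating_derivation :: "'a topology \<Rightarrow> 'a set \<Rightarrow> 'a set \<Rightarrow> omega1 \<Rightarrow> 'a set" where
  "alternating_derivation Z A B \<alpha> =
     Z closure_of ((if even_ordinal \<alpha> then A else B) \<inter>
       (\<Inter>\<beta> \<in> {..<\<alpha>}. alternating_derivation Z A B \<beta>))"
  by auto
termination
  by (relation "inv_image {(x, y). x < y} (\<lambda>(Z, A, B, \<alpha>). \<alpha>)") (auto intro: wf)

declare alternating_derivation.simps[simp del]

lemma closedin_alternating_derivation: "closedin Z (alternating_derivation Z A B \<alpha>)"
  by (subst alternating_derivation.simps) simp

lemma alternating_derivation_antimono:
  assumes "\<alpha> \<le> \<beta>"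
  shows "alternating_derivation Z A B \<beta> \<subseteq> alternating_derivation Z A B \<alpha>"
proof (cases "\<alpha> = \<beta>")
  case False
  then have "\<alpha> < \<beta>" using assms by simp
  then show ?thesis
    by (subst alternating_derivation.simps, intro closure_of_minimal)
      (auto simp: closedin_alternating_derivation)
qed simp

text \<open>The points of \<open>S\<close> in all earlier terms belong to the closure that they
  generate, so intersecting \<open>S\<close> with the new term loses none of them.\<close>

lemma alternating_derivation_dense:
  assumes "S = (if even_ordinal \<alpha> then A else B)" "S \<subseteq> topspace Z"
  shows "Z closure_of (S \<inter> alternating_derivation Z A B \<alpha>) = alternating_derivation Z A B \<alpha>"
    (is "_ = ?C \<alpha>")
proof (rule antisym)
  show "Z closure_of (S \<inter> ?C \<alpha>) \<subseteq> ?C \<alpha>"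
    by (intro closure_of_minimal) (auto simp: closedin_alternating_derivation)
  let ?I = "\<Inter>\<beta> \<in> {..<\<alpha>}. ?C \<beta>"
  have C: "?C \<alpha> = Z closure_of (S \<inter> ?I)"
    unfolding assms(1) by (rule alternating_derivation.simps)
  have "S \<inter> ?I \<subseteq> ?C \<alpha>"
    unfolding C using assms(2) by (intro closure_of_subset) auto
  then show "?C \<alpha> \<subseteq> Z closure_of (S \<inter> ?C \<alpha>)"
    by (subst (1) C, intro closure_of_mono) auto
qed

lemma mem_alternating_derivation:
  assumes "x \<in> topspace Z" "x \<in> (if even_ordinal \<alpha> then A else B)"
    "\<And>\<beta>. \<beta> < \<alpha> \<Longrightarrow> x \<in> alternating_derivation Z A B \<beta>"
  shows "x \<in> alternating_derivation Z A B \<alpha>"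
  by (subst alternating_derivation.simps, rule subsetD[OF closure_of_subset_Int])
    (use assms in auto)

lemma alternating_derivation_strict:
  assumes Z: "completely_metrizable_space Z"
    and A: "gdelta_in Z A" and B: "gdelta_in Z B" and disj: "A \<inter> B = {}"
    and "\<alpha> < \<beta>" "alternating_derivation Z A B \<alpha> \<noteq> {}"
  shows "alternating_derivation Z A B \<beta> \<subset> alternating_derivation Z A B \<alpha>" (is "?C \<beta> \<subset> ?C \<alpha>")
proof (rule ccontr)
  assume "\<not> ?C \<beta> \<subset> ?C \<alpha>"
  \<comment> \<open>The successor term lies between the other two, so a failure of strictness
    already shows at the very next stage.\<close>
  moreover have "?C \<beta> \<subseteq> ?C (succ_omega1 \<alpha>)" "?C (succ_omega1 \<alpha>) \<subseteq> ?C \<alpha>"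
    using \<open>\<alpha> < \<beta>\<close> less_succ_omega1[of \<alpha>]
    by (auto intro!: alternating_derivation_antimono succ_omega1_le)
  ultimately have eq: "?C (succ_omega1 \<alpha>) = ?C \<alpha>" by blast
  have sub: "A \<subseteq> topspace Z" "B \<subseteq> topspace Z" using A B gdelta_in_subset by auto
  \<comment> \<open>One of \<open>\<alpha>\<close> and its successor is even and the other odd, so
    one density fact concerns \<open>A\<close>, the other \<open>B\<close>, and both concern the
    same closed set.\<close>
  have "Z closure_of (A \<inter> ?C \<alpha>) = ?C \<alpha>" "Z closure_of (B \<inter> ?C \<alpha>) = ?C \<alpha>"
    using alternating_derivation_dense[OF refl, of \<alpha> A B Z]
      alternating_derivation_dense[OF refl, of "succ_omega1 \<alpha>" A B Z]
      even_succ_omega1[of \<alpha>] sub eq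
    by (auto split: if_splits)
  then have "?C \<alpha> = {}"
    using empty_if_disjoint_dense_gdelta[OF Z closedin_alternating_derivation A _ B _ disj]
    by blast
  then show False using assms(6) by simp
qed

section \<open>Termination at a countable stage\<close>

text \<open>Rationals chosen in the gaps between consecutive values would be pairwise distinct,
  injecting an uncountable set into the rationals.\<close>

lemma no_strict_antimono_omega1_real: "\<not> (\<forall>\<alpha> \<beta> :: omega1. \<alpha> < \<beta> \<longrightarrow> (f \<beta> :: real) < f \<alpha>)"
proof
  assume f: "\<forall>\<alpha> \<beta>. \<alpha> < \<beta> \<longrightarrow> f \<beta> < f \<alpha>"
  then have "\<forall>\<alpha>. \<exists>r. f (succ_omega1 \<alpha>) < real_of_rat r \<and> real_of_rat r < f \<alpha>"
    using of_rat_dense less_succ_omega1 by blast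
  then obtain r where r: "\<And>\<alpha>. f (succ_omega1 \<alpha>) < real_of_rat (r \<alpha>)"
    "\<And>\<alpha>. real_of_rat (r \<alpha>) < f \<alpha>"
    by metis
  have less: "r \<beta> < r \<alpha>" if "\<alpha> < \<beta>" for \<alpha> \<beta>
  proof -
    \<comment> \<open>The gap below \<open>f \<beta>\<close> starts no higher than where the gap
      below \<open>f \<alpha>\<close> ends, so the gaps do not overlap.\<close>
    have "f \<beta> \<le> f (succ_omega1 \<alpha>)"
      using f succ_omega1_le[OF that] by (metis order_le_less)
    then have "real_of_rat (r \<beta>) < real_of_rat (r \<alpha>)"
      using r(1)[of \<alpha>] r(2)[of \<beta>] by linarith
    then show ?thesis by (simp add: of_rat_less)
  qed
  have "inj r"
    by (rule injI) (metis less less_irrefl linorder_neqE)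
  then have "countable (UNIV :: omega1 set)"
    by (rule countableI')
  then show False using uncountable_omega1 by blast
qed

text \<open>Otherwise coding the strictly decreasing closed terms by reals would give a strictly
  decreasing real sequence indexed by all countable ordinals.\<close>

lemma alternating_derivation_reaches_empty:
  assumes "second_countable Z" "completely_metrizable_space Z"
    and "gdelta_in Z A" "gdelta_in Z B" "A \<inter> B = {}"
  shows "\<exists>\<xi>. alternating_derivation Z A B \<xi> = {}"
proof (rule ccontr)
  assume *: "\<not> ?thesis"
  obtain \<Psi> :: "'a set \<Rightarrow> real" where
    "\<forall>C D. closedin Z C \<longrightarrow> closedin Z D \<longrightarrow> C \<subset> D \<longrightarrow> \<Psi> C < \<Psi> D"
    using strictly_monotone_closed_sets[OF assms(1)] by blast
  then have "\<forall>\<alpha> \<beta>. \<alpha> < \<beta> \<longrightarrow>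
      \<Psi> (alternating_derivation Z A B \<beta>) < \<Psi> (alternating_derivation Z A B \<alpha>)"
    using alternating_derivation_strict[OF assms(2-5)] closedin_alternating_derivation * by metis
  then show False
    using no_strict_antimono_omega1_real[of "\<lambda>\<alpha>. \<Psi> (alternating_derivation Z A B \<alpha>)"] by blast
qed

section \<open>The real sequence of a pair of sets\<close>

definition derivation_length :: "'a topology \<Rightarrow> 'a set \<Rightarrow> 'a set \<Rightarrow> omega1" where
  "derivation_length Z A B = (LEAST \<xi>. alternating_derivation Z A B \<xi> = {})"

text \<open>The first empty term is kept as the last one: its code \<open>\<Psi> {} = 0\<close> is
  the final zero that \<open>decreasing_seqs\<close> demands.\<close>

definition derivation_seq ::
  "('a set \<Rightarrow> real) \<Rightarrow> 'a topology \<Rightarrow> 'a set \<Rightarrow> 'a set \<Rightarrow> omega1 \<rightharpoonup> real" where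
  "derivation_seq \<Psi> Z A B \<alpha> =
     (if \<alpha> \<le> derivation_length Z A B then Some (\<Psi> (alternating_derivation Z A B \<alpha>)) else None)"

context
  fixes Z :: "'a topology" and \<Psi> :: "'a set \<Rightarrow> real"
  assumes Z: "second_countable Z" "completely_metrizable_space Z"
    and \<Psi>: "\<Psi> {} = 0" "\<And>C. \<Psi> C \<in> {0..1}"
      "\<And>C D. closedin Z C \<Longrightarrow> closedin Z D \<Longrightarrow> C \<subset> D \<Longrightarrow> \<Psi> C < \<Psi> D"
begin

lemma alternating_derivation_eq_empty_iff:
  assumes "gdelta_in Z A" "gdelta_in Z B" "A \<inter> B = {}"
  shows "alternating_derivation Z A B \<alpha> = {} \<longleftrightarrow> derivation_length Z A B \<le> \<alpha>"
proof
  show "derivation_length Z A B \<le> \<alpha>" if "alternating_derivation Z A B \<alpha> = {}"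
    unfolding derivation_length_def using that by (rule Least_le)
  have "alternating_derivation Z A B (derivation_length Z A B) = {}"
    unfolding derivation_length_def
    using alternating_derivation_reaches_empty[OF Z assms] by (rule LeastI_ex)
  then show "alternating_derivation Z A B \<alpha> = {}" if "derivation_length Z A B \<le> \<alpha>"
    using alternating_derivation_antimono[OF that, of Z A B] by blast
qed

lemma derivation_seq_decreasing:
  assumes "gdelta_in Z A" "gdelta_in Z B" "A \<inter> B = {}"
  shows "derivation_seq \<Psi> Z A B \<in> decreasing_seqs"
proof -
  let ?x = "derivation_seq \<Psi> Z A B" and ?\<xi> = "derivation_length Z A B"
  have "dom ?x = {..?\<xi>}" by (auto simp: derivation_seq_def split: if_splits)
  moreover have "ran ?x \<subseteq> {0..1}"
    using \<Psi>(2) by (auto simp: derivation_seq_def ran_def split: if_splits)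
  moreover have "the (?x \<beta>) < the (?x \<alpha>)" if "\<alpha> < \<beta>" "\<beta> \<le> ?\<xi>" for \<alpha> \<beta>
  proof -
    have "alternating_derivation Z A B \<alpha> \<noteq> {}"
      using alternating_derivation_eq_empty_iff[OF assms] that by auto
    then show ?thesis
      using that \<Psi>(3) alternating_derivation_strict[OF Z(2) assms that(1)]
      by (auto simp: derivation_seq_def closedin_alternating_derivation)
  qed
  moreover have "?x ?\<xi> = Some 0"
    using alternating_derivation_eq_empty_iff[OF assms, THEN iffD2, OF order_refl] \<Psi>(1)
    by (simp add: derivation_seq_def)
  ultimately show ?thesis unfolding decreasing_seqs_def by blast
qed

lemma derivation_seq_altlex_less:
  assumes AB: "gdelta_in Z A" "gdelta_in Z B" "A \<inter> B = {}"
    and AB': "gdelta_in Z A'" "gdelta_in Z B'" "A' \<inter> B' = {}"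
    and sub: "A \<subseteq> A'" "B' \<subseteq> B" and x: "x \<in> A'" "x \<in> B"
  shows "altlex_less (derivation_seq \<Psi> Z A B) (derivation_seq \<Psi> Z A' B')"
proof -
  let ?C = "alternating_derivation Z A B" and ?C' = "alternating_derivation Z A' B'"
  let ?s = "derivation_seq \<Psi> Z A B" and ?s' = "derivation_seq \<Psi> Z A' B'"
  note empty = alternating_derivation_eq_empty_iff[OF AB] alternating_derivation_eq_empty_iff[OF AB']
  have "\<exists>\<alpha>. ?C \<alpha> \<noteq> ?C' \<alpha>"
  proof (rule ccontr)
    assume "\<not> ?thesis"
    then have eq: "?C \<alpha> = ?C' \<alpha>" for \<alpha> by blast
    have xZ: "x \<in> topspace Z" using x(2) gdelta_in_subset[OF AB(2)] by blast
    \<comment> \<open>At even stages \<open>x \<in> A'\<close> keeps \<open>x\<close> in the second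
      derivation, at odd stages \<open>x \<in> B\<close> keeps it in the first; the assumed equality
      transfers membership between them.\<close>
    have "x \<in> ?C \<alpha>" for \<alpha>
    proof (induction \<alpha> rule: less_induct)
      case (less \<alpha>)
      then show ?case
        using mem_alternating_derivation[OF xZ, of \<alpha> A B]
          mem_alternating_derivation[OF xZ, of \<alpha> A' B'] x eq by (cases "even_ordinal \<alpha>") auto
    qed
    then show False using empty(1) by blast
  qed
  then obtain \<delta> where \<delta>: "?C \<delta> \<noteq> ?C' \<delta>" and below: "\<And>\<beta>. \<beta> < \<delta> \<Longrightarrow> ?C \<beta> = ?C' \<beta>"
    using exists_least_iff[of "\<lambda>\<alpha>. ?C \<alpha> \<noteq> ?C' \<alpha>"] by blast
  have len: "\<delta> \<le> derivation_length Z A B" "\<delta> \<le> derivation_length Z A' B'"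
  proof -
    \<comment> \<open>An empty term before \<open>\<delta>\<close> would be common to both
      derivations and would persist, making them agree at \<open>\<delta>\<close>.\<close>
    have False if "\<beta> < \<delta>" "?C \<beta> = {}" for \<beta>
    proof -
      have "?C \<beta> = {}" "?C' \<beta> = {}" using that below[of \<beta>] by auto
      then have "?C \<delta> = {}" "?C' \<delta> = {}"
        using alternating_derivation_antimono[of \<beta> \<delta> Z A B]
          alternating_derivation_antimono[of \<beta> \<delta> Z A' B'] that(1) by auto
      then show False using \<delta> by simp
    qed
    then show "\<delta> \<le> derivation_length Z A B" "\<delta> \<le> derivation_length Z A' B'"
      using empty(1)[THEN iffD2, OF order_refl] empty(2)[THEN iffD2, OF order_refl] below
      by (metis linorder_not_le)+
  qed
  have less: "\<Psi> (?C \<delta>) < \<Psi> (?C' \<delta>)" if "even_ordinal \<delta>"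
  proof -
    \<comment> \<open>Both terms arise from the same intersection of earlier terms, so only the
      parity set matters: \<open>A \<subseteq> A'\<close> here, and \<open>B' \<subseteq> B\<close>
      with reversed effect in the odd case.\<close>
    have "?C \<delta> \<subseteq> ?C' \<delta>"
      using that below sub(1)
      by (subst (1 2) alternating_derivation.simps) (auto intro!: closure_of_mono)
    then show ?thesis using \<delta> \<Psi>(3) closedin_alternating_derivation by blast
  qed
  have greater: "\<Psi> (?C' \<delta>) < \<Psi> (?C \<delta>)" if "\<not> even_ordinal \<delta>"
  proof -
    have "?C' \<delta> \<subseteq> ?C \<delta>"
      using that below sub(2)
      by (subst (1 2) alternating_derivation.simps) (auto intro!: closure_of_mono)
    then show ?thesis using \<delta> \<Psi>(3) closedin_alternating_derivation by blast
  qed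
  have s: "?s \<delta> = Some (\<Psi> (?C \<delta>))" "?s' \<delta> = Some (\<Psi> (?C' \<delta>))"
    using len by (auto simp: derivation_seq_def)
  \<comment> \<open>The two terms are distinct and nested, so \<open>\<Psi>\<close> separates them:
    the first difference of the sets is also that of the codes.\<close>
  have neq: "?s \<delta> \<noteq> ?s' \<delta>" using less greater s by fastforce
  have "?s \<beta> = ?s' \<beta>" if "\<beta> < \<delta>" for \<beta>
    using that len below by (auto simp: derivation_seq_def)
  then have "first_diff ?s ?s' = \<delta>"
    unfolding first_diff_def using neq by (intro Least_equality) (use linorder_not_le in blast)+
  then show ?thesis
    unfolding altlex_less_def Let_def odd_ordinal_iff_not_even
    using neq s less greater by auto
qed

end

section \<open>Baire class 1 functions\<close>

text \<open>The pairs with \<open>p \<ge> q\<close> are dropped so that \<open>super_levels\<close> and \<open>sub_levels\<close> are disjoint.\<close>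

definition super_levels :: "'a topology \<Rightarrow> ('a \<Rightarrow> real) \<Rightarrow> ('a \<times> rat \<times> rat) set" where
  "super_levels X f = {(x, p, q). x \<in> topspace X \<and> p < q \<and> real_of_rat q \<le> f x}"

definition sub_levels :: "'a topology \<Rightarrow> ('a \<Rightarrow> real) \<Rightarrow> ('a \<times> rat \<times> rat) set" where
  "sub_levels X f = {(x, p, q). x \<in> topspace X \<and> p < q \<and> f x \<le> real_of_rat p}"

abbreviation level_space :: "'a topology \<Rightarrow> ('a \<times> rat \<times> rat) topology" where
  "level_space X \<equiv> prod_topology X (discrete_topology UNIV)"

text \<open>The inequality \<open>r k \<le> f x\<close> holds iff for each \<open>m\<close> some
  \<open>F n x\<close> with \<open>n \<ge> m\<close> exceeds \<open>r k - 1/(m+1)\<close>. For fixed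
  \<open>m\<close> this is an open condition, as \<open>k\<close> can be held fixed in the discrete
  factor.\<close>

lemma gdelta_in_upper_levels:
  assumes "\<And>n. continuous_map X euclideanreal (F n)"
    and "\<And>x. x \<in> topspace X \<Longrightarrow> (\<lambda>n. F n x) \<longlonglongrightarrow> f x"
  shows "gdelta_in (prod_topology X (discrete_topology UNIV))
    {(x, k). x \<in> topspace X \<and> P k \<and> r k \<le> (f x :: real)}" (is "gdelta_in ?Z ?S")
proof -
  define W where "W m = {(x, k). x \<in> topspace X \<and> P k \<and>
    (\<exists>n \<ge> m. r k - inverse (real (Suc m)) < F n x)}" for m
  have "openin ?Z (W m)" for m
    unfolding openin_prod_topology_alt
  proof (intro allI impI)
    fix x k assume "(x, k) \<in> W m"
    then obtain n where n: "x \<in> topspace X" "P k" "n \<ge> m"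
      "r k - inverse (real (Suc m)) < F n x" by (auto simp: W_def)
    let ?U = "{x \<in> topspace X. F n x \<in> {r k - inverse (real (Suc m))<..}}"
    have "openin X ?U"
      by (rule openin_continuous_map_preimage[OF assms(1)]) simp
    moreover have "x \<in> ?U" using n by simp
    moreover have "?U \<times> {k} \<subseteq> W m" using n by (auto simp: W_def)
    ultimately show "\<exists>U V. openin X U \<and> openin (discrete_topology UNIV) V \<and> x \<in> U \<and> k \<in> V \<and>
        U \<times> V \<subseteq> W m" by (intro exI[of _ ?U] exI[of _ "{k}"]) auto
  qed
  then have "gdelta_in ?Z (\<Inter>m. W m)"
    by (intro gdelta_in_Inter) (auto intro: open_imp_gdelta_in)
  moreover have "(\<Inter>m. W m) = ?S"
  proof (intro equalityI subsetI)
    fix z assume z: "z \<in> (\<Inter>m. W m)"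
    obtain x k where xk: "z = (x, k)" by (cases z)
    have W: "\<And>m. (x, k) \<in> W m" using z xk by blast
    then have x: "x \<in> topspace X" "P k" unfolding W_def by blast+
    have "r k \<le> f x"
    proof (rule ccontr)
      assume "\<not> r k \<le> f x"
      then have e: "(r k - f x) / 2 > 0" by simp
      obtain N where N: "\<And>n. n \<ge> N \<Longrightarrow> \<bar>F n x - f x\<bar> < (r k - f x) / 2"
        using LIMSEQ_D[OF assms(2)[OF x(1)] e] by auto
      obtain M where M: "inverse (real (Suc M)) < (r k - f x) / 2"
        using reals_Archimedean[OF e] by blast
      \<comment> \<open>\<open>N\<close> brings \<open>F n x\<close> below the midpoint of
        \<open>f x\<close> and \<open>r k\<close>, while \<open>M\<close> makes the tolerance small
        enough to force it above that midpoint.\<close>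
      let ?m = "max N M"
      obtain n where n: "n \<ge> ?m" "r k - inverse (real (Suc ?m)) < F n x"
        using W[of ?m] by (auto simp: W_def)
      have "inverse (real (Suc ?m)) \<le> inverse (real (Suc M))" by (intro le_imp_inverse_le) auto
      moreover have "F n x < f x + (r k - f x) / 2"
        using N[of n] n(1) unfolding abs_less_iff by linarith
      ultimately show False using n(2) M by argo
    qed
    then show "z \<in> ?S" using x xk by simp
  next
    fix z assume "z \<in> ?S"
    then obtain x k where z: "z = (x, k)" and x: "x \<in> topspace X" "P k" "r k \<le> f x" by auto
    have "(x, k) \<in> W m" for m
    proof -
      have "\<forall>\<^sub>F n in sequentially. r k - inverse (real (Suc m)) < F n x"
      proof (rule order_tendstoD(1)[OF assms(2)[OF x(1)]])
        have "0 < inverse (real (Suc m))" by simp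
        then show "r k - inverse (real (Suc m)) < f x" using x(3) by linarith
      qed
      then obtain N where "\<And>n. n \<ge> N \<Longrightarrow> r k - inverse (real (Suc m)) < F n x"
        by (auto simp: eventually_sequentially)
      then have "m \<le> max N m \<and> r k - inverse (real (Suc m)) < F (max N m) x" by simp
      then show ?thesis using x unfolding W_def by blast
    qed
    then show "z \<in> (\<Inter>m. W m)" using z by simp
  qed
  ultimately show ?thesis by simp
qed

lemma gdelta_in_levels:
  assumes "f \<in> baire_one X"
  shows "gdelta_in (level_space X) (super_levels X f)" "gdelta_in (level_space X) (sub_levels X f)"
proof -
  obtain F where F: "\<And>n. continuous_map X euclideanreal (F n)"
    "\<And>x. x \<in> topspace X \<Longrightarrow> (\<lambda>n. F n x) \<longlonglongrightarrow> f x"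
    using assms unfolding baire_one_def by blast
  have "super_levels X f =
      {(x, k). x \<in> topspace X \<and> fst k < snd k \<and> real_of_rat (snd k) \<le> f x}"
    by (auto simp: super_levels_def)
  then show "gdelta_in (level_space X) (super_levels X f)"
    using gdelta_in_upper_levels[OF F, of "\<lambda>k. fst k < snd k" "\<lambda>k. real_of_rat (snd k)"] by simp
  \<comment> \<open>Sub-levels of \<open>f\<close> are upper levels of \<open>- f\<close>, the
    pointwise limit of the functions \<open>- F n\<close>.\<close>
  have "sub_levels X f =
      {(x, k). x \<in> topspace X \<and> fst k < snd k \<and> - real_of_rat (fst k) \<le> - f x}"
    by (auto simp: sub_levels_def)
  moreover have "gdelta_in (level_space X)
      {(x, k). x \<in> topspace X \<and> fst k < snd k \<and> - real_of_rat (fst k) \<le> - f x}"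
    by (rule gdelta_in_upper_levels[of X "\<lambda>n x. - F n x" "\<lambda>x. - f x" "\<lambda>k. fst k < snd k"
          "\<lambda>k. - real_of_rat (fst k)"])
      (use F in \<open>auto intro: continuous_map_minus tendsto_minus\<close>)
  ultimately show "gdelta_in (level_space X) (sub_levels X f)" by simp
qed

lemma levels_disjoint: "super_levels X f \<inter> sub_levels X f = {}"
proof -
  have False if "p < q" "real_of_rat q \<le> f x" "f x \<le> real_of_rat p" for x p q
    using that of_rat_less[of p q, where 'a = real] by linarith
  then show ?thesis by (auto simp: super_levels_def sub_levels_def)
qed

theorem theorem3p1:
  fixes X :: "'a topology"
  assumes "Polish_space X"
  shows "order_embeds (baire_one X) (pointwise_less X) decreasing_seqs altlex_less"
proof -
  have X: "second_countable X" "completely_metrizable_space X"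
    using assms second_countable_if_separable_metrizable completely_metrizable_imp_metrizable_space
    unfolding Polish_space_def by auto
  have Z: "second_countable (level_space X)" "completely_metrizable_space (level_space X)"
    using X by (auto intro: second_countable_prod_discrete
        simp: completely_metrizable_space_prod_topology completely_metrizable_space_discrete_topology)
  obtain \<Psi> :: "('a \<times> rat \<times> rat) set \<Rightarrow> real" where \<Psi>: "\<Psi> {} = 0" "\<And>C. \<Psi> C \<in> {0..1}"
    "\<And>C D. closedin (level_space X) C \<Longrightarrow> closedin (level_space X) D \<Longrightarrow> C \<subset> D \<Longrightarrow> \<Psi> C < \<Psi> D"
    using strictly_monotone_closed_sets[OF Z(1)] by (auto simp: image_subset_iff)
  \<comment> \<open>A single \<open>\<Psi>\<close> serves all functions, so that codes belonging to
    different functions are comparable.\<close>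
  let ?\<Phi> = "\<lambda>f. derivation_seq \<Psi> (level_space X) (super_levels X f) (sub_levels X f)"
  show ?thesis
    unfolding order_embeds_def
  proof (intro exI[of _ ?\<Phi>] conjI ballI impI Pi_I)
    fix f assume "f \<in> baire_one X"
    then show "?\<Phi> f \<in> decreasing_seqs"
      by (intro derivation_seq_decreasing[where \<Psi> = \<Psi>, OF Z \<Psi>] gdelta_in_levels levels_disjoint)
  next
    fix f g assume f: "f \<in> baire_one X" and g: "g \<in> baire_one X" and "pointwise_less X f g"
    then obtain x where le: "\<And>y. y \<in> topspace X \<Longrightarrow> f y \<le> g y"
      and x: "x \<in> topspace X" "f x < g x"
      unfolding pointwise_less_def by blast
    \<comment> \<open>Rationals with \<open>f x < p < q < g x\<close> put \<open>(x, p, q)\<close>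
      in a super-level set of \<open>g\<close> and a sub-level set of \<open>f\<close>: this is the
      point that makes the two derivations differ.\<close>
    obtain q where q: "f x < real_of_rat q" "real_of_rat q < g x"
      using of_rat_dense[OF x(2)] by blast
    obtain p where p: "f x < real_of_rat p" "real_of_rat p < real_of_rat q"
      using of_rat_dense[OF q(1)] by blast
    have "(x, p, q) \<in> super_levels X g" "(x, p, q) \<in> sub_levels X f"
      using x(1) p q by (auto simp: super_levels_def sub_levels_def of_rat_less)
    moreover have "super_levels X f \<subseteq> super_levels X g" "sub_levels X g \<subseteq> sub_levels X f"
      using le by (fastforce simp: super_levels_def sub_levels_def)+
    ultimately show "altlex_less (?\<Phi> f) (?\<Phi> g)"
      by (intro derivation_seq_altlex_less[where \<Psi> = \<Psi>, OF Z \<Psi> gdelta_in_levels[OF f]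
            levels_disjoint gdelta_in_levels[OF g] levels_disjoint])
  qed
qed

end
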